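(* Let $G$ be a finite simple graph on $[n]$ with edge ideal $I(G)\subset S=K[x_1,\dots,x_n]$. Then, for all integers $k\ge2$, $$I(G)^{\langle k+1\rangle}:I(G)\ =\ I(G)^{\langle k\rangle}.$$
   Context: $K$ is a field and $S=K[x_1,\dots,x_n]$ is the standard graded polynomial ring. For a finite simple graph $G$ with vertex set $[n]=\{1,\dots,n\}$ and edge set $E(G)$, the edge ideal $I(G)\subset S$ is the ideal generated by the monomials $x_ix_j$ with $\{i,j\}\in E(G)$. For a monomial ideal $I\subset S$ with minimal monomial generating set $\mathcal{G}(I)=\{u_1,\dots,u_m\}$ and an integer $k\ge2$, the $k$th non-pure power of $I$ is $$I^{\langle k\rangle}=(u_{i_1}\cdots u_{i_k} : 1\le i_1\le\dots\le i_k\le m,\ |\{i_1,\dots,i_k\}|>1).$$ For ideals $J,L\subset S$, $J:L$ denotes the colon ideal $\{f\in S: fL\subseteq J\}$.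
   Formalization: The graph G is assumed to have at least one edge; for an edgeless graph I(G)=0, so the left side is 0:0=S while the right side is 0, and the stated equality fails. *)

theory Defs
  imports "HOL-Algebra.Ideal" "HOL-Library.Poly_Mapping" "HOL-Library.Multiset"
begin

text \<open>Polynomials with coefficients in a field \<open>'k\<close> and variables indexed by the natural numbers
  are finitely supported maps from exponent vectors to coefficients; the type class multiplication
  on this type is the convolution product.\<close>

type_synonym 'k mpoly = "(nat \<Rightarrow>\<^sub>0 nat) \<Rightarrow>\<^sub>0 'k"

definition poly_ring :: "nat \<Rightarrow> ('k::field) mpoly ring" where
  "poly_ring n =
    \<lparr>carrier = {p. \<forall>m \<in> Poly_Mapping.keys p. Poly_Mapping.keys m \<subseteq> {1..n}},
     monoid.mult = (*), one = 1, zero = 0, add = (+)\<rparr>"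

definition Var :: "nat \<Rightarrow> ('k::field) mpoly" where
  "Var i = Poly_Mapping.single (Poly_Mapping.single i 1) 1"

definition monomials :: "nat \<Rightarrow> ('k::field) mpoly set" where
  "monomials n = {Poly_Mapping.single m 1 | m. Poly_Mapping.keys m \<subseteq> {1..n}}"

definition minimal_monomial_generators ::
    "nat \<Rightarrow> ('k::field) mpoly set \<Rightarrow> 'k mpoly set \<Rightarrow> bool" where
  "minimal_monomial_generators n I U \<longleftrightarrow>
     U \<subseteq> monomials n \<and> Idl\<^bsub>poly_ring n\<^esub> U = I \<and>
     (\<forall>V. V \<subset> U \<longrightarrow> Idl\<^bsub>poly_ring n\<^esub> V \<noteq> I)"

text \<open>Only meaningful for monomial ideals \<open>I\<close>. Uniqueness of the minimal generating set is proved
  below.\<close>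

definition mon_gens :: "nat \<Rightarrow> ('k::field) mpoly set \<Rightarrow> 'k mpoly set" where
  "mon_gens n I = (THE U. minimal_monomial_generators n I U)"

text \<open>The weakly increasing index sequences \<open>i\<^sub>1 \<le> \<dots> \<le> i\<^sub>k\<close> are the multisets of size \<open>k\<close> over the
  minimal generators, the \<open>u\<^sub>i\<close> being pairwise distinct.\<close>

definition nonpure_power :: "nat \<Rightarrow> nat \<Rightarrow> ('k::field) mpoly set \<Rightarrow> 'k mpoly set" where
  "nonpure_power n k I =
     Idl\<^bsub>poly_ring n\<^esub>
       {prod_mset M | M. set_mset M \<subseteq> mon_gens n I \<and> size M = k \<and> card (set_mset M) > 1}"

definition colon_ideal :: "('a, 'b) ring_scheme \<Rightarrow> 'a set \<Rightarrow> 'a set \<Rightarrow> 'a set" where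
  "colon_ideal R J L = {f \<in> carrier R. \<forall>g \<in> L. f \<otimes>\<^bsub>R\<^esub> g \<in> J}"

definition simple_graph :: "nat \<Rightarrow> nat set set \<Rightarrow> bool" where
  "simple_graph n E \<longleftrightarrow> (\<forall>e \<in> E. e \<subseteq> {1..n} \<and> card e = 2)"

definition edge_ideal :: "nat \<Rightarrow> nat set set \<Rightarrow> ('k::field) mpoly set" where
  "edge_ideal n E = Idl\<^bsub>poly_ring n\<^esub> {Var i * Var j | i j. {i, j} \<in> E}"

lemma keys_add_nat:
  "Poly_Mapping.keys (s + t) = Poly_Mapping.keys s \<union> Poly_Mapping.keys (t :: 'a \<Rightarrow>\<^sub>0 nat)"
  by (auto simp: in_keys_iff lookup_add)

lemma cring_poly_ring: "cring (poly_ring n :: ('k::field) mpoly ring)"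
proof -
  let ?R = "poly_ring n :: 'k mpoly ring"
  have add: "p + q \<in> carrier ?R" if "p \<in> carrier ?R" "q \<in> carrier ?R" for p q
    using that Poly_Mapping.keys_add[of p q] unfolding poly_ring_def by auto
  have uminus: "- p \<in> carrier ?R" if "p \<in> carrier ?R" for p
    using that unfolding poly_ring_def by simp
  have mult: "p * q \<in> carrier ?R" if "p \<in> carrier ?R" "q \<in> carrier ?R" for p q
  proof -
    have "Poly_Mapping.keys m \<subseteq> {1..n}" if "m \<in> Poly_Mapping.keys (p * q)" for m
    proof -
      from that keys_mult[of p q] obtain c d
        where "m = c + d" "c \<in> Poly_Mapping.keys p" "d \<in> Poly_Mapping.keys q" by blast
      with \<open>p \<in> _\<close> \<open>q \<in> _\<close> show ?thesis by (simp add: poly_ring_def keys_add_nat)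
    qed
    then show ?thesis by (simp add: poly_ring_def)
  qed
  have zero_one: "0 \<in> carrier ?R" "1 \<in> carrier ?R"
    by (simp_all add: poly_ring_def)
  have ops: "x \<oplus>\<^bsub>?R\<^esub> y = x + y" "x \<otimes>\<^bsub>?R\<^esub> y = x * y" "\<zero>\<^bsub>?R\<^esub> = 0" "\<one>\<^bsub>?R\<^esub> = 1" for x y
    by (simp_all add: poly_ring_def)
  show ?thesis
  proof (rule cringI)
    show "abelian_group ?R"
    proof (rule abelian_groupI)
      fix x assume "x \<in> carrier ?R"
      then show "\<exists>y\<in>carrier ?R. y \<oplus>\<^bsub>?R\<^esub> x = \<zero>\<^bsub>?R\<^esub>"
        using uminus by (intro bexI[of _ "- x"]) (simp_all add: ops)
    qed (simp_all only: ops add zero_one ac_simps add_0_left add_0_right)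
    show "comm_monoid ?R"
      by (rule comm_monoidI) (simp_all only: ops mult zero_one ac_simps mult_1_left mult_1_right)
  qed (simp only: ops distrib_right)
qed

lemma monomial_in_genideal:
  fixes U :: "('k::field) mpoly set"
  assumes "U \<subseteq> monomials n" "Poly_Mapping.single m 1 \<in> Idl\<^bsub>poly_ring n\<^esub> U"
  shows "\<exists>s t. Poly_Mapping.single s 1 \<in> U \<and> m = s + t"
proof -
  let ?R = "poly_ring n :: 'k mpoly ring"
  interpret cring ?R by (rule cring_poly_ring)
  define I where "I = {p \<in> carrier ?R. \<forall>m \<in> Poly_Mapping.keys p.
      \<exists>s t. Poly_Mapping.single s (1::'k) \<in> U \<and> m = s + t}"
  have "ideal I ?R"
  proof (rule idealI)
    show "ring ?R" by (rule ring_axioms)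
    show "subgroup I (add_monoid ?R)"
    proof (rule add.subgroupI)
      show "I \<subseteq> carrier ?R" by (auto simp: I_def)
      have "0 \<in> I" by (simp add: I_def poly_ring_def)
      then show "I \<noteq> {}" by blast
      show "\<ominus>\<^bsub>?R\<^esub> a \<in> I" if a: "a \<in> I" for a
      proof -
        have ac: "a \<in> carrier ?R" using a by (simp add: I_def)
        then have mc: "- a \<in> carrier ?R" by (simp add: poly_ring_def)
        have "- a \<oplus>\<^bsub>?R\<^esub> a = \<zero>\<^bsub>?R\<^esub>" by (simp add: poly_ring_def)
        then have "\<ominus>\<^bsub>?R\<^esub> a = - a" using minus_equality ac mc by blast
        then show ?thesis using a mc by (simp add: I_def)
      qed
      show "a \<oplus>\<^bsub>?R\<^esub> b \<in> I" if "a \<in> I" "b \<in> I" for a b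
      proof -
        have "a \<oplus>\<^bsub>?R\<^esub> b \<in> carrier ?R" using that by (intro a_closed) (auto simp: I_def)
        moreover have "a \<oplus>\<^bsub>?R\<^esub> b = a + b" by (simp add: poly_ring_def)
        ultimately show ?thesis
          using that Poly_Mapping.keys_add[of a b] unfolding I_def by auto
      qed
    qed
    have mul: "x * a \<in> I" if "a \<in> I" "x \<in> carrier ?R" for a x
    proof -
      have "x \<otimes>\<^bsub>?R\<^esub> a \<in> carrier ?R" using that by (intro m_closed) (auto simp: I_def)
      moreover have "x \<otimes>\<^bsub>?R\<^esub> a = x * a" by (simp add: poly_ring_def)
      moreover have "\<exists>s t. Poly_Mapping.single s (1::'k) \<in> U \<and> m = s + t"
        if "m \<in> Poly_Mapping.keys (x * a)" for m
      proof -
        from that keys_mult[of x a] obtain c d where "m = c + d" "d \<in> Poly_Mapping.keys a" by blast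
        moreover from this(2) \<open>a \<in> I\<close> obtain s t where "Poly_Mapping.single s (1::'k) \<in> U" "d = s + t"
          unfolding I_def by blast
        ultimately have "m = s + (c + t)" by (simp add: algebra_simps)
        with \<open>Poly_Mapping.single s 1 \<in> U\<close> show ?thesis by blast
      qed
      ultimately show ?thesis unfolding I_def by auto
    qed
    show "x \<otimes>\<^bsub>?R\<^esub> a \<in> I" if "a \<in> I" "x \<in> carrier ?R" for a x
      using mul[OF that] by (simp add: poly_ring_def)
    show "a \<otimes>\<^bsub>?R\<^esub> x \<in> I" if "a \<in> I" "x \<in> carrier ?R" for a x
      using mul[OF that] by (simp add: poly_ring_def mult.commute)
  qed
  moreover have "U \<subseteq> I"
  proof
    fix u assume u: "u \<in> U"
    then obtain s where s: "u = Poly_Mapping.single s 1" "Poly_Mapping.keys s \<subseteq> {1..n}"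
      using assms(1) unfolding monomials_def by blast
    have "\<exists>r t. Poly_Mapping.single r (1::'k) \<in> U \<and> s = r + t"
      using u s(1) by (intro exI[of _ s] exI[of _ 0]) simp
    with s show "u \<in> I" by (simp add: I_def poly_ring_def)
  qed
  ultimately have "Idl\<^bsub>?R\<^esub> U \<subseteq> I" by (auto simp: genideal_def)
  with assms(2) have "Poly_Mapping.single m 1 \<in> I" by blast
  then show ?thesis unfolding I_def by auto
qed

lemma minimal_monomial_generators_subset:
  fixes I :: "('k::field) mpoly set"
  assumes U: "minimal_monomial_generators n I U" and V: "minimal_monomial_generators n I V"
  shows "U \<subseteq> V"
proof
  let ?R = "poly_ring n :: 'k mpoly ring"
  interpret cring ?R by (rule cring_poly_ring)
  have sub: "W \<subseteq> carrier ?R" if W: "W \<subseteq> monomials n" for W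
  proof
    fix w assume "w \<in> W"
    then obtain m where "w = Poly_Mapping.single m 1" "Poly_Mapping.keys m \<subseteq> {1..n}"
      using W unfolding monomials_def by blast
    then show "w \<in> carrier ?R" by (simp add: poly_ring_def)
  qed
  have Um: "U \<subseteq> monomials n" and UI: "Idl\<^bsub>?R\<^esub> U = I"
    and Vm: "V \<subseteq> monomials n" and VI: "Idl\<^bsub>?R\<^esub> V = I"
    using U V unfolding minimal_monomial_generators_def by auto
  fix u assume u: "u \<in> U"
  then obtain m where m: "u = Poly_Mapping.single m 1" "Poly_Mapping.keys m \<subseteq> {1..n}"
    using Um unfolding monomials_def by blast
  have "u \<in> Idl\<^bsub>?R\<^esub> V" using genideal_self[OF sub[OF Um]] u UI VI by blast
  then obtain s t where st: "Poly_Mapping.single s 1 \<in> V" "m = s + t"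
    using monomial_in_genideal[OF Vm] m by blast
  have "Poly_Mapping.single s 1 \<in> Idl\<^bsub>?R\<^esub> U"
    using genideal_self[OF sub[OF Vm]] st UI VI by blast
  then obtain r t' where rt: "Poly_Mapping.single r 1 \<in> U" "s = r + t'"
    using monomial_in_genideal[OF Um] by blast
  have "r = m"
  proof (rule ccontr)
    assume "r \<noteq> m"
    define W where "W = U - {u}"
    have "Poly_Mapping.single r (1::'k) \<noteq> u"
    proof
      assume "Poly_Mapping.single r (1::'k) = u"
      then have "Poly_Mapping.keys (Poly_Mapping.single r (1::'k)) = Poly_Mapping.keys u" by simp
      with m \<open>r \<noteq> m\<close> show False by simp
    qed
    then have rW: "Poly_Mapping.single r 1 \<in> W" using rt W_def by blast
    have Wc: "W \<subseteq> carrier ?R" using sub[OF Um] W_def by blast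
    have id: "ideal (Idl\<^bsub>?R\<^esub> W) ?R" by (rule genideal_ideal[OF Wc])
    have "Poly_Mapping.single (t' + t) (1::'k) \<in> carrier ?R"
      using m(2) st(2) rt(2) by (auto simp: poly_ring_def keys_add_nat)
    then have "Poly_Mapping.single (t' + t) 1 \<otimes>\<^bsub>?R\<^esub> Poly_Mapping.single r 1 \<in> Idl\<^bsub>?R\<^esub> W"
      using ideal.I_l_closed[OF id] genideal_self[OF Wc] rW by blast
    then have "u \<in> Idl\<^bsub>?R\<^esub> W"
      using m(1) st(2) rt(2) by (simp add: poly_ring_def mult_single algebra_simps)
    then have "U \<subseteq> Idl\<^bsub>?R\<^esub> W" using genideal_self[OF Wc] W_def by blast
    then have "I \<subseteq> Idl\<^bsub>?R\<^esub> W" using genideal_minimal[OF id] UI by blast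
    moreover have "Idl\<^bsub>?R\<^esub> W \<subseteq> I"
      using genideal_minimal[OF genideal_ideal[OF sub[OF Um]]] genideal_self[OF sub[OF Um]] UI W_def
      by blast
    moreover have "W \<subset> U" using u W_def by blast
    ultimately show False using U unfolding minimal_monomial_generators_def by blast
  qed
  then have "t' + t = 0" using st(2) rt(2) by (simp add: add.assoc)
  then have "t = 0" by (metis keys_add_nat keys_eq_empty sup_eq_bot_iff)
  then show "u \<in> V" using m(1) st by simp
qed

lemma mon_gens_eqI: "minimal_monomial_generators n I U \<Longrightarrow> mon_gens n I = U"
  unfolding mon_gens_def
  by (rule the_equality) (blast dest: minimal_monomial_generators_subset)+

end

theory Submission
  imports Defs
begin

text \<open>All ideals involved are monomial, so the claim is about exponent vectors: if for every edge
  \<open>e\<close> the monomial \<open>x\<^sup>m x\<^sup>e\<close> is divisible by a non-pure product of \<open>k + 1\<close> edges, then \<open>x\<^sup>m\<close> is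
  divisible by a non-pure product of \<open>k\<close> edges; the opposite inclusion of ideals is immediate. The
  translation between ideals and exponents rests on \<open>genideal_monom_image_iff\<close> (a polynomial lies
  in a monomial ideal iff each of its monomials does) and on \<open>mon_gens_edge_ideal\<close>, by which the
  minimal generators of an edge ideal are the edge monomials.

  The main point is the same claim for ordinary powers, \<open>packs_colon\<close>. A product of edges dividing
  \<open>x\<^sup>m\<close> is a matching in the graph in which each vertex \<open>v\<close> is replaced by \<open>m v\<close> twins. Let \<open>r\<close> be
  the largest size of such a matching. Adding one twin at both ends of an edge raises the maximum by
  \<open>1\<close> or \<open>2\<close>, and it has to be shown that some edge raises it by exactly \<open>1\<close>. Suppose not. Then
  for every edge \<open>ij\<close> some maximum matching exposes a neighbour of \<open>i\<close> together with a neighbour of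
  \<open>j\<close> (\<open>neighbours_exposed\<close>). In particular there is an edge \<open>ps\<close> both of whose ends are
  exposed by maximum matchings, and there are neighbours \<open>a\<close> of \<open>p\<close> and \<open>b\<close> of \<open>s\<close> exposed
  together. A maximum matching never exposes two adjacent vertices, as it could be enlarged. The
  transitivity known from the proof of Gallai's lemma (\<open>exposed_transitive\<close>), used at \<open>p\<close>, shows
  that \<open>a\<close> and \<open>p\<close> or \<open>p\<close> and \<open>b\<close> are exposed together, hence \<open>p\<close> and \<open>b\<close>, since \<open>ap\<close> is an edge.
  Used at \<open>s\<close>, it shows next that \<open>p\<close> and \<open>s\<close> or \<open>s\<close> and \<open>b\<close> are exposed together; both pairs
  are edges, a contradiction.

  Non-purity costs little more (\<open>nonpure_packs_colon\<close>): if the product of \<open>k\<close> edges dividing \<open>x\<^sup>m\<close>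
  happens to be a pure power of an edge \<open>e\<close>, then \<open>m\<close> is at least \<open>k\<close> at both ends of \<open>e\<close>. Remove a
  factor from a non-pure product of \<open>k + 1\<close> edges dividing \<open>x\<^sup>m x\<^sup>e\<close>, chosen so that the rest stays
  non-pure. What remains divides \<open>x\<^sup>m\<close>, since \<open>k\<close> edges have degree at most \<open>k\<close> at
  each vertex.\<close>

section \<open>Packing edges into an exponent vector\<close>

abbreviation lookup :: "('a \<Rightarrow>\<^sub>0 'b::zero) \<Rightarrow> 'a \<Rightarrow> 'b" where
  "lookup \<equiv> Poly_Mapping.lookup"

definition unit_vec :: "'a \<Rightarrow> 'a \<Rightarrow>\<^sub>0 nat" where
  "unit_vec v = Poly_Mapping.single v 1"

abbreviation pointwise_le :: "('a \<Rightarrow>\<^sub>0 nat) \<Rightarrow> ('a \<Rightarrow>\<^sub>0 nat) \<Rightarrow> bool" (infix \<open>\<preceq>\<close> 50) where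
  "a \<preceq> b \<equiv> \<forall>v. lookup a v \<le> lookup b v"

definition edge_vectors :: "'a set set \<Rightarrow> ('a \<Rightarrow>\<^sub>0 nat) set" where
  "edge_vectors E = {unit_vec i + unit_vec j | i j. {i, j} \<in> E}"

text \<open>The vector \<open>y\<close> is the part of the capacities \<open>m\<close> that has to be left free: for \<open>r\<close> maximal and
  \<open>y\<close> a sum of unit vectors, this says that some maximum matching exposes the vertices in \<open>y\<close>,
  counted with multiplicity.\<close>

definition packs :: "'a set set \<Rightarrow> nat \<Rightarrow> ('a \<Rightarrow>\<^sub>0 nat) \<Rightarrow> ('a \<Rightarrow>\<^sub>0 nat) \<Rightarrow> bool" where
  "packs E r y m \<longleftrightarrow>
     (\<exists>F. set_mset F \<subseteq> edge_vectors E \<and> size F = r \<and> sum_mset F + y \<preceq> m)"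

lemma pointwise_le_iff: "a \<preceq> b \<longleftrightarrow> (\<exists>t. b = a + t)"
proof
  assume "a \<preceq> b"
  then have "b = a + (b - a)"
    by (intro poly_mapping_eqI) (simp add: lookup_add lookup_minus)
  then show "\<exists>t. b = a + t" ..
qed (auto simp: lookup_add)

lemma lookup_unit_vec: "lookup (unit_vec v) u = (if u = v then 1 else 0)"
  by (simp add: unit_vec_def lookup_single when_def)

lemma lookup_sum_mset: "lookup (sum_mset F) v = (\<Sum>e\<in>#F. lookup e v)"
  by (induction F) (simp_all add: lookup_add)

lemma edge_at_vertex:
  assumes "\<forall>e\<in>E. card e = 2" "set_mset F \<subseteq> edge_vectors E" "0 < lookup (sum_mset F) v"
  obtains w where "unit_vec v + unit_vec w \<in># F" "{v, w} \<in> E" "w \<noteq> v"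
proof -
  have "\<exists>e\<in>#F. lookup e v \<noteq> 0"
  proof (rule ccontr)
    assume "\<not> ?thesis"
    then have "lookup (sum_mset F) v = 0" by (auto simp: lookup_sum_mset)
    then show False using assms(3) by simp
  qed
  then obtain i j where ij: "unit_vec i + unit_vec j \<in># F" "{i, j} \<in> E"
    "lookup (unit_vec i + unit_vec j) v \<noteq> 0"
    using assms(2) unfolding edge_vectors_def by blast
  have "i \<noteq> j" using assms(1) ij(2) by force
  with ij that show thesis
    by (auto simp: lookup_add lookup_unit_vec insert_commute add.commute split: if_splits)
qed

lemma edge_vectorI: "{i, j} \<in> E \<Longrightarrow> unit_vec i + unit_vec j \<in> edge_vectors E"
  by (auto simp: edge_vectors_def)

text \<open>This is the alternating path of the symmetric difference of two matchings, started at a vertex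
  \<open>v\<close> with an edge of \<open>F\<^sub>1\<close>, expressed through degree vectors only. In the first case the path has
  even length, and exchanging along it moves one unit of degree of \<open>F\<^sub>1\<close> from \<open>v\<close> to \<open>t\<close>; in the
  second it has odd length and augments \<open>F\<^sub>2\<close>. The path is built by taking an edge \<open>vw\<close> of \<open>F\<^sub>1\<close>.
  Either it can be added to \<open>F\<^sub>2\<close>, or the path continues from \<open>w\<close> with the roles of the matchings
  exchanged and \<open>vw\<close> deleted from \<open>F\<^sub>1\<close>. That deletion makes the induction terminate and keeps the
  strict inequality of degrees alive at \<open>w\<close>.\<close>

lemma alternating_walk:
  assumes "\<forall>e\<in>E. card e = 2"
    and "set_mset F\<^sub>1 \<subseteq> edge_vectors E" "set_mset F\<^sub>2 \<subseteq> edge_vectors E"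
    and "lookup (sum_mset F\<^sub>2) v < lookup (sum_mset F\<^sub>1) v"
  shows "(\<exists>G t. set_mset G \<subseteq> edge_vectors E \<and> size G = size F\<^sub>1
            \<and> sum_mset G + unit_vec v = sum_mset F\<^sub>1 + unit_vec t
            \<and> lookup (sum_mset F\<^sub>1) t < lookup (sum_mset F\<^sub>2) t)
       \<or> (\<exists>G t. set_mset G \<subseteq> edge_vectors E \<and> size G = Suc (size F\<^sub>2)
            \<and> sum_mset G = sum_mset F\<^sub>2 + unit_vec v + unit_vec t
            \<and> lookup (sum_mset F\<^sub>2 + unit_vec v) t < lookup (sum_mset F\<^sub>1) t)"
  using assms(2-4)
proof (induction "size F\<^sub>1 + size F\<^sub>2" arbitrary: F\<^sub>1 F\<^sub>2 v rule: less_induct)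
  case less
  obtain w where w: "unit_vec v + unit_vec w \<in># F\<^sub>1" "{v, w} \<in> E" "w \<noteq> v"
    using edge_at_vertex[OF assms(1) less.prems(1), of v] less.prems(3) by auto
  define e where "e = unit_vec v + unit_vec w"
  have e: "e \<in># F\<^sub>1" "e \<in> edge_vectors E" using w edge_vectorI by (auto simp: e_def)
  define F where "F = F\<^sub>1 - {#e#}"
  have F1: "F\<^sub>1 = add_mset e F" using e by (simp add: F_def)
  have FE: "set_mset F \<subseteq> edge_vectors E" using less.prems(1) F1 by auto
  have d1: "sum_mset F\<^sub>1 = sum_mset F + unit_vec v + unit_vec w"
    by (simp add: F1 e_def ac_simps)
  show ?case
  proof (cases "lookup (sum_mset F\<^sub>2) w < lookup (sum_mset F\<^sub>1) w")
    case True
    have "\<exists>G t. set_mset G \<subseteq> edge_vectors E \<and> size G = Suc (size F\<^sub>2)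
            \<and> sum_mset G = sum_mset F\<^sub>2 + unit_vec v + unit_vec t
            \<and> lookup (sum_mset F\<^sub>2 + unit_vec v) t < lookup (sum_mset F\<^sub>1) t"
      using e less.prems(2) True w(3)
      by (intro exI[of _ "add_mset e F\<^sub>2"] exI[of _ w])
        (auto simp: e_def ac_simps lookup_add lookup_unit_vec)
    then show ?thesis ..
  next
    case False
    have less_w: "lookup (sum_mset F) w < lookup (sum_mset F\<^sub>2) w"
      using False by (simp add: d1 lookup_add lookup_unit_vec)
    have "size F\<^sub>2 + size F < size F\<^sub>1 + size F\<^sub>2" by (simp add: F1)
    \<comment> \<open>The two outcomes for the exchanged roles become, after putting \<open>vw\<close> back, the two
      outcomes for the original roles in reversed order.\<close>
    from less.hyps[OF this less.prems(2) FE less_w] show ?thesis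
    proof (elim disjE exE conjE)
      fix G t
      assume G: "set_mset G \<subseteq> edge_vectors E" "size G = size F\<^sub>2"
        "sum_mset G + unit_vec w = sum_mset F\<^sub>2 + unit_vec t"
        "lookup (sum_mset F\<^sub>2) t < lookup (sum_mset F) t"
      have "sum_mset (add_mset e G) = unit_vec v + (sum_mset G + unit_vec w)"
        by (simp add: e_def ac_simps)
      also have "\<dots> = sum_mset F\<^sub>2 + unit_vec v + unit_vec t" by (simp add: G(3) ac_simps)
      finally have "sum_mset (add_mset e G) = sum_mset F\<^sub>2 + unit_vec v + unit_vec t" .
      moreover have "lookup (sum_mset F\<^sub>2 + unit_vec v) t < lookup (sum_mset F\<^sub>1) t"
        using G(4) by (simp add: d1 lookup_add lookup_unit_vec)
      ultimately have "\<exists>G t. set_mset G \<subseteq> edge_vectors E \<and> size G = Suc (size F\<^sub>2)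
            \<and> sum_mset G = sum_mset F\<^sub>2 + unit_vec v + unit_vec t
            \<and> lookup (sum_mset F\<^sub>2 + unit_vec v) t < lookup (sum_mset F\<^sub>1) t"
        using e G(1,2) by (intro exI[of _ "add_mset e G"] exI[of _ t]) auto
      then show ?thesis ..
    next
      fix G t
      assume G: "set_mset G \<subseteq> edge_vectors E" "size G = Suc (size F)"
        "sum_mset G = sum_mset F + unit_vec w + unit_vec t"
        "lookup (sum_mset F + unit_vec w) t < lookup (sum_mset F\<^sub>2) t"
      have "t \<noteq> v"
        using G(4) less.prems(3) w(3) by (auto simp: d1 lookup_add lookup_unit_vec)
      then have "lookup (sum_mset F\<^sub>1) t < lookup (sum_mset F\<^sub>2) t"
        using G(4) by (simp add: d1 lookup_add lookup_unit_vec)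
      moreover have "sum_mset G + unit_vec v = sum_mset F\<^sub>1 + unit_vec t"
        by (simp add: G(3) d1 ac_simps)
      moreover have "size G = size F\<^sub>1" by (simp add: G(2) F1)
      ultimately show ?thesis using G(1) by blast
    qed
  qed
qed

lemma packs_mono:
  assumes "packs E r y m" "z \<preceq> y"
  shows "packs E r z m"
proof -
  obtain F where F: "set_mset F \<subseteq> edge_vectors E" "size F = r" "sum_mset F + y \<preceq> m"
    using assms(1) unfolding packs_def by blast
  have "lookup (sum_mset F + z) v \<le> lookup m v" for v
    using F(3)[rule_format, of v] assms(2)[rule_format, of v] by (simp add: lookup_add)
  then show ?thesis using F(1,2) unfolding packs_def by blast
qed

lemma packs_antimono_size:
  assumes "packs E r y m" "s \<le> r"
  shows "packs E s y m"
  using assms(2,1)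
proof (induction rule: inc_induct)
  case (step s)
  then obtain F where F: "set_mset F \<subseteq> edge_vectors E" "size F = Suc s" "sum_mset F + y \<preceq> m"
    unfolding packs_def by blast
  then obtain e G where G: "F = add_mset e G" by (metis size_eq_Suc_imp_eq_union)
  have "lookup (sum_mset G + y) v \<le> lookup m v" for v
    using F(3)[rule_format, of v] by (simp add: G lookup_add)
  then show ?case using F(1,2) G unfolding packs_def by auto
qed

lemma packs_edge:
  assumes "packs E r (unit_vec i + unit_vec j) m" "unit_vec i + unit_vec j \<in> edge_vectors E"
  shows "packs E (Suc r) 0 m"
proof -
  obtain F where "set_mset F \<subseteq> edge_vectors E" "size F = r"
    "sum_mset F + (unit_vec i + unit_vec j) \<preceq> m"
    using assms(1) unfolding packs_def by blast
  with assms(2) show ?thesis unfolding packs_def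
    by (intro exI[of _ "add_mset (unit_vec i + unit_vec j) F"]) (auto simp: lookup_add ac_simps)
qed

text \<open>Call two vertices related if no maximum matching exposes both; the lemma says that this relation is
  transitive through any vertex \<open>v\<close> that some maximum matching exposes. Take a maximum matching
  exposing \<open>u\<close> and \<open>w\<close> and exchange it along the alternating path from \<open>v\<close> towards a maximum matching
  exposing \<open>v\<close>; maximality forces this path to have even length. The result exposes \<open>v\<close>, and the path can end in at most one of \<open>u\<close> and \<open>w\<close>, so
  the other one stays exposed.\<close>

lemma exposed_transitive:
  assumes "\<forall>e\<in>E. card e = 2" and max: "\<not> packs E (Suc r) 0 m"
    and uw: "packs E r (unit_vec u + unit_vec w) m" and v: "packs E r (unit_vec v) m"
  shows "packs E r (unit_vec u + unit_vec v) m \<or> packs E r (unit_vec v + unit_vec w) m"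
proof -
  obtain F\<^sub>1 where F1: "set_mset F\<^sub>1 \<subseteq> edge_vectors E" "size F\<^sub>1 = r"
    "sum_mset F\<^sub>1 + (unit_vec u + unit_vec w) \<preceq> m"
    using uw unfolding packs_def by blast
  obtain F\<^sub>2 where F2: "set_mset F\<^sub>2 \<subseteq> edge_vectors E" "size F\<^sub>2 = r"
    "sum_mset F\<^sub>2 + unit_vec v \<preceq> m"
    using v unfolding packs_def by blast
  show ?thesis
  proof (cases "lookup (sum_mset F\<^sub>1) v < lookup m v")
    case True
    show ?thesis
    proof (cases "u = v")
      case True
      then show ?thesis using uw by (simp add: ac_simps)
    next
      case False
      have "lookup (sum_mset F\<^sub>1 + (unit_vec u + unit_vec v)) z \<le> lookup m z" for z
        using F1(3)[rule_format, of z] True False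
        by (auto simp: lookup_add lookup_unit_vec split: if_splits)
      then show ?thesis using F1 unfolding packs_def by blast
    qed
  next
    case False
    have "lookup (sum_mset F\<^sub>2) v < lookup (sum_mset F\<^sub>1) v"
      using F2(3)[rule_format, of v] False by (simp add: lookup_add lookup_unit_vec)
    from alternating_walk[OF assms(1) F1(1) F2(1) this] show ?thesis
    proof (elim disjE exE conjE)
      fix G t
      assume G: "set_mset G \<subseteq> edge_vectors E" "size G = size F\<^sub>1"
        "sum_mset G + unit_vec v = sum_mset F\<^sub>1 + unit_vec t"
        "lookup (sum_mset F\<^sub>1) t < lookup (sum_mset F\<^sub>2) t"
      show ?thesis
      proof (cases "t = u")
        case True
        then have "sum_mset G + (unit_vec v + unit_vec w) \<preceq> m"
          using F1(3) by (simp add: add.assoc[symmetric] G(3))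
        then show ?thesis using G(1,2) F1(2) unfolding packs_def by auto
      next
        case False
        have "lookup (sum_mset F\<^sub>1 + unit_vec t + unit_vec u) z \<le> lookup m z" for z
          using F1(3)[rule_format, of z] F2(3)[rule_format, of z] G(4) False
          by (auto simp: lookup_add lookup_unit_vec split: if_splits)
        moreover have "sum_mset G + (unit_vec u + unit_vec v) = sum_mset F\<^sub>1 + unit_vec t + unit_vec u"
          unfolding G(3)[symmetric] by (simp add: ac_simps)
        ultimately have "sum_mset G + (unit_vec u + unit_vec v) \<preceq> m" by simp
        then show ?thesis using G(1,2) F1(2) unfolding packs_def by auto
      qed
    next
      fix G t
      assume G: "set_mset G \<subseteq> edge_vectors E" "size G = Suc (size F\<^sub>2)"
        "sum_mset G = sum_mset F\<^sub>2 + unit_vec v + unit_vec t"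
        "lookup (sum_mset F\<^sub>2 + unit_vec v) t < lookup (sum_mset F\<^sub>1) t"
      have "lookup (sum_mset G + 0) z \<le> lookup m z" for z
        using F1(3)[rule_format, of z] F2(3)[rule_format, of z] G(3,4)
        by (auto simp: lookup_add lookup_unit_vec split: if_splits)
      then have "packs E (Suc r) 0 m" using G(1,2) F2(2) unfolding packs_def by blast
      then show ?thesis using max by blast
    qed
  qed
qed

lemma packs_remove_vertex:
  assumes "\<forall>e\<in>E. card e = 2" "packs E (Suc r) 0 (m + unit_vec v)"
  shows "packs E r 0 m"
proof -
  obtain F where F: "set_mset F \<subseteq> edge_vectors E" "size F = Suc r" "sum_mset F \<preceq> m + unit_vec v"
    using assms(2) unfolding packs_def by auto
  show ?thesis
  proof (cases "0 < lookup (sum_mset F) v")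
    case True
    then obtain w where w: "unit_vec v + unit_vec w \<in># F"
      using edge_at_vertex[OF assms(1) F(1)] by blast
    define G where "G = F - {#unit_vec v + unit_vec w#}"
    have FG: "F = add_mset (unit_vec v + unit_vec w) G" using w by (simp add: G_def)
    have "lookup (sum_mset G + 0) z \<le> lookup m z" for z
      using F(3)[rule_format, of z] by (simp add: FG lookup_add)
    then show ?thesis using F(1,2) FG unfolding packs_def by auto
  next
    case False
    have "lookup (sum_mset F + 0) z \<le> lookup m z" for z
      using F(3)[rule_format, of z] False
      by (auto simp: lookup_add lookup_unit_vec split: if_splits)
    then have "packs E (Suc r) 0 m" using F unfolding packs_def by blast
    then show ?thesis by (rule packs_antimono_size) simp
  qed
qed

text \<open>A packing that gains two edges from the new twins of \<open>i\<close> and \<open>j\<close> must cover both twins, and by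
  two different edges \<open>ip\<close> and \<open>jq\<close>, since otherwise a single removal would leave \<open>r + 1\<close> edges
  within \<open>m\<close>. Deleting both edges leaves \<open>p\<close> and \<open>q\<close> exposed.\<close>

lemma neighbours_exposed:
  assumes E: "\<forall>e\<in>E. card e = 2" and max: "\<not> packs E (Suc r) 0 m"
    and grow: "packs E (Suc (Suc r)) 0 (m + (unit_vec i + unit_vec j))"
  obtains p q where "{i, p} \<in> E" "{j, q} \<in> E" "packs E r (unit_vec p + unit_vec q) m"
proof -
  obtain F where F: "set_mset F \<subseteq> edge_vectors E" "size F = Suc (Suc r)"
    "sum_mset F \<preceq> m + (unit_vec i + unit_vec j)"
    using grow unfolding packs_def by auto
  have "0 < lookup (sum_mset F) i"
  proof (rule ccontr)
    assume "\<not> ?thesis"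
    then have "lookup (sum_mset F + 0) z \<le> lookup (m + unit_vec j) z" for z
      using F(3)[rule_format, of z] by (auto simp: lookup_add lookup_unit_vec split: if_splits)
    then have "packs E (Suc (Suc r)) 0 (m + unit_vec j)" using F(1,2) unfolding packs_def by blast
    then show False using packs_remove_vertex[OF E] max by blast
  qed
  then obtain p where p: "unit_vec i + unit_vec p \<in># F" "{i, p} \<in> E"
    using edge_at_vertex[OF E F(1)] by blast
  define G where "G = F - {#unit_vec i + unit_vec p#}"
  have FG: "F = add_mset (unit_vec i + unit_vec p) G" using p by (simp add: G_def)
  have GE: "set_mset G \<subseteq> edge_vectors E" using F(1) FG by auto
  have Gm: "sum_mset G + unit_vec p \<preceq> m + unit_vec j"
    using F(3) by (simp add: FG lookup_add ac_simps)
  have "0 < lookup (sum_mset G) j"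
  proof (rule ccontr)
    assume "\<not> ?thesis"
    then have "lookup (sum_mset G + 0) z \<le> lookup m z" for z
      using Gm[rule_format, of z] by (auto simp: lookup_add lookup_unit_vec split: if_splits)
    then have "packs E (Suc r) 0 m" using GE F(2) FG unfolding packs_def by auto
    then show False using max by blast
  qed
  then obtain q where q: "unit_vec j + unit_vec q \<in># G" "{j, q} \<in> E"
    using edge_at_vertex[OF E GE] by blast
  define H where "H = G - {#unit_vec j + unit_vec q#}"
  have GH: "G = add_mset (unit_vec j + unit_vec q) H" using q by (simp add: H_def)
  have "lookup (sum_mset H + (unit_vec p + unit_vec q)) z \<le> lookup m z" for z
    using Gm[rule_format, of z] by (simp add: GH lookup_add)
  then have "packs E r (unit_vec p + unit_vec q) m"
    using GE F(2) FG GH unfolding packs_def by (intro exI[of _ H]) auto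
  then show thesis using p(2) q(2) that by blast
qed

lemma some_edge_grows_by_one:
  assumes E: "\<forall>e\<in>E. card e = 2" and "E \<noteq> {}" and max: "\<not> packs E (Suc r) 0 m"
  shows "\<exists>e\<in>edge_vectors E. \<not> packs E (Suc (Suc r)) 0 (m + e)"
proof (rule ccontr)
  assume "\<not> ?thesis"
  then have grow: "packs E (Suc (Suc r)) 0 (m + (unit_vec i + unit_vec j))" if "{i, j} \<in> E" for i j
    using edge_vectorI[OF that] by auto
  have nadj: "\<not> packs E r (unit_vec i + unit_vec j) m" if "{i, j} \<in> E" for i j
    using packs_edge[OF _ edge_vectorI[OF that]] max by blast
  have single: "packs E r (unit_vec p) m" "packs E r (unit_vec q) m"
    if "packs E r (unit_vec p + unit_vec q) m" for p q
    using that by (auto elim!: packs_mono simp: lookup_add)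
  \<comment> \<open>Two applications of the growth assumption produce an edge \<open>ps\<close> with both ends exposable; the
    third one, at that edge, yields the vertices \<open>a\<close> and \<open>b\<close> of the contradiction.\<close>
  from assms(2) obtain e where "e \<in> E" by blast
  then obtain i j where "{i, j} \<in> E" using E by (metis card_2_iff)
  from neighbours_exposed[OF E max grow[OF this]] obtain p q
    where "{i, p} \<in> E" "packs E r (unit_vec p + unit_vec q) m" by metis
  then have p: "{p, i} \<in> E" "packs E r (unit_vec p) m" using single by (auto simp: insert_commute)
  from neighbours_exposed[OF E max grow[OF p(1)]] obtain s q
    where "{p, s} \<in> E" "packs E r (unit_vec s + unit_vec q) m" by metis
  then have s: "{p, s} \<in> E" "packs E r (unit_vec s) m" using single by blast+
  from neighbours_exposed[OF E max grow[OF s(1)]] obtain a b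
    where ab: "{p, a} \<in> E" "{s, b} \<in> E" "packs E r (unit_vec a + unit_vec b) m" by metis
  have "{a, p} \<in> E" using ab(1) by (simp add: insert_commute)
  then have pb: "packs E r (unit_vec p + unit_vec b) m"
    using exposed_transitive[OF E max ab(3) p(2)] nadj by simp
  show False
    using exposed_transitive[OF E max pb s(2)] nadj[OF s(1)] nadj[OF ab(2)] by simp
qed

text \<open>On the level of exponents this is \<open>I\<^sup>k\<^sup>+\<^sup>1 : I \<subseteq> I\<^sup>k\<close> for the edge ideal \<open>I\<close>. If the maximal
  size \<open>r\<close> were below \<open>k\<close>, then \<open>r + 2 \<le> k + 1\<close>, and every edge would raise the maximum
  by \<open>2\<close>, contrary to \<open>some_edge_grows_by_one\<close>.\<close>

lemma packs_colon:
  assumes "\<forall>e\<in>E. card e = 2" and "E \<noteq> {}"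
    and grow: "\<forall>e\<in>edge_vectors E. packs E (Suc k) 0 (m + e)"
  shows "packs E k 0 m"
proof (rule ccontr)
  assume "\<not> packs E k 0 m"
  moreover have "\<not> \<not> packs E 0 0 m" by (auto simp: packs_def)
  ultimately obtain r where r: "r < k" "\<forall>i\<le>r. \<not> \<not> packs E i 0 m" "\<not> packs E (Suc r) 0 m"
    using ex_least_nat_less[of "\<lambda>k. \<not> packs E k 0 m" k] by blast
  then obtain e where "e \<in> edge_vectors E" "\<not> packs E (Suc (Suc r)) 0 (m + e)"
    using some_edge_grows_by_one assms by blast
  then show False using grow packs_antimono_size[of E "Suc k" 0 "m + e" "Suc (Suc r)"] r(1) by auto
qed

section \<open>Non-pure packings\<close>

definition nonpure_packs :: "'a set set \<Rightarrow> nat \<Rightarrow> ('a \<Rightarrow>\<^sub>0 nat) \<Rightarrow> bool" where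
  "nonpure_packs E k m \<longleftrightarrow>
     (\<exists>N. set_mset N \<subseteq> edge_vectors E \<and> size N = k \<and> card (set_mset N) > 1 \<and> sum_mset N \<preceq> m)"

text \<open>Remove a repeated element if there is one; otherwise at least three distinct elements are present,
  and any of them may go.\<close>

lemma nonpure_remove_one:
  assumes "card (set_mset N) > 1" "size N \<ge> 3"
  obtains g where "g \<in># N" "card (set_mset (N - {#g#})) > 1"
proof (cases "\<exists>g. count N g \<ge> 2")
  case True
  then obtain g where g: "count N g \<ge> 2" ..
  then have gN: "g \<in># N" by (simp flip: count_greater_zero_iff)
  have "x \<in># N - {#g#} \<longleftrightarrow> x \<in># N" for x
  proof (cases "x = g")
    case True
    then show ?thesis using g gN by (simp add: in_diff_count)
  qed (simp add: in_diff_count)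
  then have "set_mset (N - {#g#}) = set_mset N" by blast
  then show thesis using assms(1) gN that by simp
next
  case False
  have "size N = (\<Sum>g\<in>set_mset N. count N g)" by (rule size_multiset_overloaded_eq)
  also have "\<dots> = (\<Sum>g\<in>set_mset N. 1)"
  proof (rule sum.cong)
    fix g assume "g \<in># N"
    then have "count N g > 0" by simp
    then show "count N g = 1" using False by (metis One_nat_def Suc_leI le_antisym not_less_eq_eq numeral_2_eq_2)
  qed simp
  finally have card: "card (set_mset N) \<ge> 3" using assms(2) by simp
  obtain g where g: "g \<in># N" using assms(1) by fastforce
  have "set_mset N - {g} \<subseteq> set_mset (N - {#g#})"
  proof
    fix x assume "x \<in> set_mset N - {g}"
    then show "x \<in># N - {#g#}" by (auto simp: in_diff_count)
  qed
  then have "card (set_mset N - {g}) \<le> card (set_mset (N - {#g#}))" by (intro card_mono) auto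
  then have "card (set_mset (N - {#g#})) > 1" using card g by (simp add: card_Diff_singleton)
  then show thesis using g that by blast
qed

lemma lookup_edge_vector_le:
  assumes "\<forall>e\<in>E. card e = 2" "g \<in> edge_vectors E"
  shows "lookup g v \<le> 1"
proof -
  obtain i j where ij: "g = unit_vec i + unit_vec j" "{i, j} \<in> E"
    using assms(2) unfolding edge_vectors_def by blast
  then have "i \<noteq> j" using assms(1) by force
  then show ?thesis by (simp add: ij(1) lookup_add lookup_unit_vec)
qed

lemma lookup_sum_edge_vectors_le:
  assumes "\<forall>e\<in>E. card e = 2" "set_mset N \<subseteq> edge_vectors E"
  shows "lookup (sum_mset N) v \<le> size N"
  using assms(2)
proof (induction N)
  case (add g N)
  then show ?case using lookup_edge_vector_le[OF assms(1), of g v] by (simp add: lookup_add)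
qed simp

lemma nonpure_packs_imp_packs: "nonpure_packs E k m \<Longrightarrow> packs E k 0 m"
  unfolding nonpure_packs_def packs_def by auto

text \<open>Only the case where the packing of size \<open>k\<close> provided by \<open>packs_colon\<close> is pure, say \<open>k\<close> copies of \<open>e\<close>,
  needs an argument. Then a non-pure packing \<open>N\<close> of \<open>m + e\<close> loses a suitable element; off \<open>e\<close> the
  remainder obeys the bound for \<open>N\<close>, and at the ends of \<open>e\<close> its degree is at most its size \<open>k\<close>,
  while \<open>m\<close> is at least \<open>k\<close> there. The bound \<open>k \<ge> 2\<close> is what allows the removal to keep two distinct edges.\<close>

lemma nonpure_packs_colon:
  assumes E: "\<forall>e\<in>E. card e = 2" and "E \<noteq> {}" and k: "k \<ge> 2"
    and grow: "\<forall>e\<in>edge_vectors E. nonpure_packs E (Suc k) (m + e)"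
  shows "nonpure_packs E k m"
proof -
  have "\<forall>e\<in>edge_vectors E. packs E (Suc k) 0 (m + e)"
    using grow nonpure_packs_imp_packs by blast
  then have "packs E k 0 m" by (rule packs_colon[OF assms(1,2)])
  then obtain F where F: "set_mset F \<subseteq> edge_vectors E" "size F = k" "sum_mset F \<preceq> m"
    unfolding packs_def by auto
  show ?thesis
  proof (cases "card (set_mset F) > 1")
    case True
    then show ?thesis using F unfolding nonpure_packs_def by blast
  next
    case False
    have "F \<noteq> {#}" using F(2) k by auto
    then have "card (set_mset F) \<noteq> 0" by simp
    with False have "card (set_mset F) = 1" by linarith
    then obtain e where e: "set_mset F = {e}" by (metis card_1_singletonE)
    then have Fe: "F = replicate_mset k e"
      using F(2) by (metis set_mset_subset_singletonD subset_refl)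
    have eE: "e \<in> edge_vectors E" using F(1) e by simp
    have pure: "k * lookup e v \<le> lookup m v" for v
      using F(3)[rule_format, of v] by (simp add: Fe lookup_sum_mset)
    obtain N where N: "set_mset N \<subseteq> edge_vectors E" "size N = Suc k" "card (set_mset N) > 1"
      "sum_mset N \<preceq> m + e"
      using grow eE unfolding nonpure_packs_def by blast
    obtain g where g: "g \<in># N" "card (set_mset (N - {#g#})) > 1"
      using nonpure_remove_one[OF N(3)] N(2) k by auto
    define G where "G = N - {#g#}"
    have NG: "N = add_mset g G" using g(1) by (simp add: G_def)
    have GE: "set_mset G \<subseteq> edge_vectors E" "size G = k" using N(1,2) by (auto simp: NG)
    have "lookup (sum_mset G) v \<le> lookup m v" for v
    proof (cases "lookup e v = 0")
      case True
      then show ?thesis using N(4)[rule_format, of v] by (simp add: NG lookup_add)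
    next
      case False
      then have "k \<le> k * lookup e v" by simp
      then have "k \<le> lookup m v" using pure[of v] by (rule order_trans)
      then show ?thesis using lookup_sum_edge_vectors_le[OF E GE(1), of v] GE(2) by simp
    qed
    then show ?thesis using GE g(2) unfolding nonpure_packs_def G_def by blast
  qed
qed

lemma nonpure_packs_add:
  assumes "nonpure_packs E k m" "e \<in> edge_vectors E"
  shows "nonpure_packs E (Suc k) (m + e)"
proof -
  obtain N where N: "set_mset N \<subseteq> edge_vectors E" "size N = k" "card (set_mset N) > 1" "sum_mset N \<preceq> m"
    using assms(1) unfolding nonpure_packs_def by blast
  have "card (set_mset N) \<le> card (set_mset (add_mset e N))" by (intro card_mono) auto
  then show ?thesis using N assms(2) unfolding nonpure_packs_def
    by (intro exI[of _ "add_mset e N"]) (auto simp: lookup_add)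
qed

lemma nonpure_packs_mono:
  assumes "nonpure_packs E k m"
  shows "nonpure_packs E k (m + t)"
proof -
  obtain N where N: "set_mset N \<subseteq> edge_vectors E" "size N = k" "card (set_mset N) > 1" "sum_mset N \<preceq> m"
    using assms unfolding nonpure_packs_def by blast
  have "sum_mset N \<preceq> m + t" using N(4) by (simp add: lookup_add trans_le_add1)
  then show ?thesis using N(1-3) unfolding nonpure_packs_def by blast
qed

section \<open>Monomial ideals\<close>

abbreviation monom :: "'a \<Rightarrow> 'a \<Rightarrow>\<^sub>0 'k::field" where
  "monom m \<equiv> Poly_Mapping.single m 1"

lemma monomial_times_in_ideal:
  fixes U :: "('k::field) mpoly set"
  assumes "ideal I (poly_ring n)" "monom s \<in> I" "Poly_Mapping.keys t \<subseteq> {1..n}"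
  shows "Poly_Mapping.single (s + t) c \<in> I"
proof -
  have "Poly_Mapping.single t c \<in> carrier (poly_ring n)" using assms(3) by (simp add: poly_ring_def)
  from ideal.I_l_closed[OF assms(1,2) this] show ?thesis
    by (simp add: poly_ring_def mult_single add.commute)
qed

lemma in_ideal_if_terms_in_ideal:
  fixes p :: "('k::field) mpoly"
  assumes I: "ideal I (poly_ring n)"
    and "\<forall>m\<in>Poly_Mapping.keys p. Poly_Mapping.single m (lookup p m) \<in> I"
  shows "p \<in> I"
  using assms(2)
proof (induction p rule: update_induct)
  case const
  have "\<zero>\<^bsub>poly_ring n\<^esub> \<in> I"
    by (rule additive_subgroup.zero_closed[OF ideal.axioms(1)[OF I]])
  then show ?case by (simp add: poly_ring_def)
next
  case (update f a b)
  have upd: "Poly_Mapping.update a b f = Poly_Mapping.single a b + f"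
    using update.hyps(1)
    by (intro poly_mapping_eqI) (auto simp: lookup_update lookup_add lookup_single when_def in_keys_iff)
  have "f \<in> I"
  proof (rule update.IH, rule ballI)
    fix m assume m: "m \<in> Poly_Mapping.keys f"
    then have "m \<noteq> a" using update.hyps(1) by blast
    with m update.prems update.hyps show "Poly_Mapping.single m (lookup f m) \<in> I"
      by (auto simp: lookup_update keys_update)
  qed
  moreover have "Poly_Mapping.single a b \<in> I"
    using update.prems update.hyps by (auto simp: lookup_update keys_update)
  ultimately have "Poly_Mapping.single a b \<oplus>\<^bsub>poly_ring n\<^esub> f \<in> I"
    by (intro additive_subgroup.a_closed[OF ideal.axioms(1)[OF I]])
  then show ?case by (simp add: upd poly_ring_def)
qed

lemma monomials_subset_carrier: "U \<subseteq> monomials n \<Longrightarrow> U \<subseteq> carrier (poly_ring n)"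
proof
  fix u
  assume "U \<subseteq> monomials n" "u \<in> U"
  then obtain m where "u = monom m" "Poly_Mapping.keys m \<subseteq> {1..n}"
    unfolding monomials_def by blast
  then show "u \<in> carrier (poly_ring n)" by (simp add: poly_ring_def)
qed

text \<open>The polynomials all of whose monomials are divisible by a generator form an ideal, because
  divisibility by a generator persists under multiplication. It is the least one containing the
  generators, because each of its elements is a sum of terms that are multiples of generators.\<close>

lemma genideal_monom_image_iff:
  assumes D: "\<forall>s\<in>D. Poly_Mapping.keys s \<subseteq> {1..n}"
  shows "p \<in> Idl\<^bsub>poly_ring n\<^esub> (monom ` D :: ('k::field) mpoly set) \<longleftrightarrow>
    p \<in> carrier (poly_ring n) \<and> (\<forall>m\<in>Poly_Mapping.keys p. \<exists>s\<in>D. s \<preceq> m)"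
proof -
  let ?R = "poly_ring n :: 'k mpoly ring" and ?U = "monom ` D :: 'k mpoly set"
  interpret cring ?R by (rule cring_poly_ring)
  have Uc: "?U \<subseteq> carrier ?R" using D by (auto simp: poly_ring_def)
  define M where "M = {m. \<exists>s\<in>D. s \<preceq> m}"
  have M_add: "c + d \<in> M" if d: "d \<in> M" for c d
  proof -
    obtain s where s: "s \<in> D" "s \<preceq> d" using d unfolding M_def by blast
    have "s \<preceq> c + d" using s(2) by (simp add: lookup_add trans_le_add2)
    then show ?thesis using s(1) unfolding M_def by blast
  qed
  define I where "I = {p \<in> carrier ?R. Poly_Mapping.keys p \<subseteq> M}"
  have mult: "x * a \<in> I" if a: "a \<in> I" and x: "x \<in> carrier ?R" for a x
  proof -
    have "x \<otimes>\<^bsub>?R\<^esub> a \<in> carrier ?R" using a x by (intro m_closed) (auto simp: I_def)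
    moreover have "Poly_Mapping.keys (x * a) \<subseteq> M"
      using keys_mult[of x a] a M_add unfolding I_def by blast
    ultimately show ?thesis by (simp add: I_def poly_ring_def)
  qed
  have "ideal I ?R"
  proof (rule idealI)
    show "ring ?R" by (rule ring_axioms)
    show "subgroup I (add_monoid ?R)"
    proof (rule add.subgroupI)
      show "I \<subseteq> carrier ?R" by (auto simp: I_def)
      have "0 \<in> I" by (simp add: I_def poly_ring_def)
      then show "I \<noteq> {}" by blast
    next
      fix a assume a: "a \<in> I"
      then have "\<ominus>\<^bsub>?R\<^esub> a = - a"
        by (intro minus_equality) (simp_all add: I_def poly_ring_def)
      then show "\<ominus>\<^bsub>?R\<^esub> a \<in> I" using a by (simp add: I_def poly_ring_def)
    next
      fix a b assume ab: "a \<in> I" "b \<in> I"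
      have "a \<oplus>\<^bsub>?R\<^esub> b \<in> carrier ?R" using ab by (intro a_closed) (auto simp: I_def)
      moreover have "Poly_Mapping.keys (a + b) \<subseteq> M"
        using Poly_Mapping.keys_add[of a b] ab unfolding I_def by blast
      ultimately show "a \<oplus>\<^bsub>?R\<^esub> b \<in> I" by (simp add: I_def poly_ring_def)
    qed
    show "x \<otimes>\<^bsub>?R\<^esub> a \<in> I" "a \<otimes>\<^bsub>?R\<^esub> x \<in> I" if "a \<in> I" "x \<in> carrier ?R" for a x
      using mult[OF that] by (simp_all add: poly_ring_def mult.commute)
  qed
  moreover have "?U \<subseteq> I"
  proof
    fix u assume u: "u \<in> ?U"
    then obtain s where s: "u = monom s" "s \<in> D" by blast
    then have "s \<in> M" unfolding M_def by blast
    then show "u \<in> I" using u Uc by (auto simp: I_def s(1))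
  qed
  ultimately have "Idl\<^bsub>?R\<^esub> ?U \<subseteq> I" by (rule genideal_minimal)
  moreover have "I \<subseteq> Idl\<^bsub>?R\<^esub> ?U"
  proof
    fix p assume p: "p \<in> I"
    show "p \<in> Idl\<^bsub>?R\<^esub> ?U"
    proof (rule in_ideal_if_terms_in_ideal[OF genideal_ideal[OF Uc]], rule ballI)
      fix m assume m: "m \<in> Poly_Mapping.keys p"
      then obtain s t where st: "s \<in> D" "m = s + t"
        using p unfolding I_def M_def pointwise_le_iff by blast
      have "Poly_Mapping.keys m \<subseteq> {1..n}" using m p by (auto simp: I_def poly_ring_def)
      then have "Poly_Mapping.keys t \<subseteq> {1..n}" by (simp add: st(2) keys_add_nat)
      moreover have "monom s \<in> Idl\<^bsub>?R\<^esub> ?U" using st(1) genideal_self[OF Uc] by blast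
      ultimately show "Poly_Mapping.single m (lookup p m) \<in> Idl\<^bsub>?R\<^esub> ?U"
        unfolding st(2) by (intro monomial_times_in_ideal[OF genideal_ideal[OF Uc]])
    qed
  qed
  ultimately have "Idl\<^bsub>?R\<^esub> ?U = I" by blast
  then show ?thesis by (auto simp: I_def M_def)
qed

lemma keys_times_monom:
  assumes "m \<in> Poly_Mapping.keys (f :: ('k::field) mpoly)"
  shows "m + e \<in> Poly_Mapping.keys (f * monom e)"
proof -
  have "(\<lambda>q. lookup (monom e :: 'k mpoly) q when m + e = l + q) = (\<lambda>q. (1 when l = m) when q = e)" for l
    by (auto simp: lookup_single when_def)
  then have "(\<Sum>q. lookup (monom e :: 'k mpoly) q when m + e = l + q) = (1 when l = m)" for l
    by (simp only: Sum_any_when_equal)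
  then have "lookup (f * monom e) (m + e) = (\<Sum>l. lookup f l * (1 when l = m))"
    by (simp only: lookup_mult)
  also have "\<dots> = lookup f m" by (simp add: mult_when)
  finally have "lookup (f * monom e) (m + e) = lookup f m" .
  then show ?thesis using assms by (simp add: in_keys_iff)
qed

section \<open>Non-pure powers of edge ideals\<close>

lemma inj_monom: "inj (monom :: 'a \<Rightarrow> 'a \<Rightarrow>\<^sub>0 'k::field)"
proof (rule injI)
  fix a b :: 'a
  assume "(monom a :: 'a \<Rightarrow>\<^sub>0 'k) = monom b"
  then have "Poly_Mapping.keys (monom a :: 'a \<Rightarrow>\<^sub>0 'k) = Poly_Mapping.keys (monom b :: 'a \<Rightarrow>\<^sub>0 'k)" by simp
  then show "a = b" by simp
qed

lemma card_image_monom: "card ((monom :: 'a \<Rightarrow> 'a \<Rightarrow>\<^sub>0 'k::field) ` A) = card A"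
  by (rule card_image[OF inj_on_subset[OF inj_monom]]) simp

lemma edge_generators_eq:
  "{Var i * Var j | i j. {i, j} \<in> E} = (monom ` edge_vectors E :: ('k::field) mpoly set)"
proof -
  have "Var i * Var j = (monom (unit_vec i + unit_vec j) :: 'k mpoly)" for i j
    by (simp add: Var_def unit_vec_def mult_single)
  then show ?thesis unfolding edge_vectors_def by auto
qed

lemma keys_edge_vector:
  assumes "simple_graph n E" "e \<in> edge_vectors E"
  shows "Poly_Mapping.keys e \<subseteq> {1..n}"
proof -
  obtain i j where "e = unit_vec i + unit_vec j" "{i, j} \<in> E"
    using assms(2) unfolding edge_vectors_def by blast
  moreover have "{i, j} \<subseteq> {1..n}" using assms(1) \<open>{i, j} \<in> E\<close> unfolding simple_graph_def by blast
  ultimately show ?thesis by (simp add: keys_add_nat unit_vec_def)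
qed

lemma edge_monomials:
  assumes "simple_graph n E"
  shows "(monom ` edge_vectors E :: ('k::field) mpoly set) \<subseteq> monomials n"
  using keys_edge_vector[OF assms] by (auto simp: monomials_def)

text \<open>No edge monomial properly divides another, hence none of them is redundant as a generator.\<close>

lemma edge_vector_antichain:
  assumes "\<forall>e\<in>E. card e = 2" "s \<in> edge_vectors E" "s + t \<in> edge_vectors E"
  shows "t = 0"
proof -
  obtain i j where s: "s = unit_vec i + unit_vec j" "{i, j} \<in> E"
    using assms(2) unfolding edge_vectors_def by blast
  obtain a b where st: "s + t = unit_vec a + unit_vec b" "{a, b} \<in> E"
    using assms(3) unfolding edge_vectors_def by blast
  have "i \<noteq> j" using assms(1) s(2) by force
  have "lookup s v \<le> lookup (unit_vec a + unit_vec b) v" for v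
    by (simp flip: st(1) add: lookup_add)
  from this[of i] this[of j] have "i = a \<and> j = b \<or> i = b \<and> j = a"
    using \<open>i \<noteq> j\<close> by (auto simp: s lookup_add lookup_unit_vec split: if_splits)
  then have "unit_vec i + unit_vec j = unit_vec a + unit_vec b" by (auto simp: add.commute)
  with st(1) have "s + t = s" by (simp only: s(1))
  then show ?thesis by simp
qed

lemma mon_gens_edge_ideal:
  assumes "simple_graph n E"
  shows "mon_gens n (edge_ideal n E :: ('k::field) mpoly set) = monom ` edge_vectors E"
proof (rule mon_gens_eqI, unfold minimal_monomial_generators_def, intro conjI allI impI notI)
  let ?U = "monom ` edge_vectors E :: 'k mpoly set"
  interpret cring "poly_ring n :: 'k mpoly ring" by (rule cring_poly_ring)
  show U: "?U \<subseteq> monomials n" by (rule edge_monomials[OF assms])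
  show gen: "Idl\<^bsub>poly_ring n\<^esub> ?U = edge_ideal n E"
    by (simp add: edge_ideal_def edge_generators_eq)
  fix V assume V: "V \<subset> ?U" "Idl\<^bsub>poly_ring n\<^esub> V = (edge_ideal n E :: 'k mpoly set)"
  then obtain e where e: "e \<in> edge_vectors E" "monom e \<notin> V" by blast
  have "monom e \<in> Idl\<^bsub>poly_ring n\<^esub> V"
    using genideal_self[OF monomials_subset_carrier[OF U]] e(1) V(2) gen by blast
  moreover have "V \<subseteq> monomials n" using V(1) U by blast
  ultimately obtain s t where st: "monom s \<in> V" "e = s + t" using monomial_in_genideal by blast
  have "(monom s :: 'k mpoly) \<in> ?U" using st(1) V(1) by blast
  then have "s \<in> edge_vectors E" by (simp only: inj_image_mem_iff[OF inj_monom])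
  moreover have "\<forall>e\<in>E. card e = 2" using assms by (simp add: simple_graph_def)
  ultimately have "t = 0" using edge_vector_antichain e(1) st(2) by blast
  then show False using st e(2) by simp
qed

lemma prod_mset_monom:
  "prod_mset (image_mset monom N) = (monom (sum_mset N) :: ('k::field) mpoly)"
  by (induction N) (simp_all add: mult_single)

text \<open>Sending exponent vectors to monomials is injective, so multisets of generators and multisets of
  edge vectors correspond with their numbers of distinct elements.\<close>

lemma nonpure_generators_eq:
  assumes "simple_graph n E"
  shows "{prod_mset M | M. set_mset M \<subseteq> mon_gens n (edge_ideal n E :: ('k::field) mpoly set)
            \<and> size M = k \<and> card (set_mset M) > 1}
       = monom ` sum_mset ` {N. set_mset N \<subseteq> edge_vectors E \<and> size N = k \<and> card (set_mset N) > 1}"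
    (is "?L = monom ` sum_mset ` ?N")
proof (intro equalityI subsetI)
  have card: "card (set_mset (image_mset (monom :: _ \<Rightarrow> 'k mpoly) N)) = card (set_mset N)"
    for N :: "(nat \<Rightarrow>\<^sub>0 nat) multiset"
    by (simp add: card_image_monom)
  {
    fix p assume "p \<in> ?L"
    then obtain M where M: "p = prod_mset M" "set_mset M \<subseteq> monom ` edge_vectors E"
        "size M = k" "card (set_mset M) > 1"
      unfolding mon_gens_edge_ideal[OF assms] by blast
    define N where "N = image_mset (inv_into (edge_vectors E) monom) M"
    have "monom (inv_into (edge_vectors E) monom x) = x" if "x \<in># M" for x
      by (rule f_inv_into_f) (use that M(2) in blast)
    then have "image_mset monom N = image_mset (\<lambda>x. x) M"
      unfolding N_def multiset.map_comp by (intro image_mset_cong) simp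
    then have MN: "M = image_mset monom N" by simp
    have "set_mset N \<subseteq> edge_vectors E"
      using M(2) unfolding N_def by (auto intro: inv_into_into)
    then have "N \<in> ?N" using M(3,4) card[of N] by (simp add: MN)
    moreover have "p = monom (sum_mset N)" by (simp only: M(1) MN prod_mset_monom)
    ultimately show "p \<in> monom ` sum_mset ` ?N" by blast
  }
  {
    fix p :: "'k mpoly" assume "p \<in> monom ` sum_mset ` ?N"
    then obtain N where N: "p = monom (sum_mset N)" "N \<in> ?N" by blast
    show "p \<in> ?L"
      unfolding mon_gens_edge_ideal[OF assms]
      by (intro CollectI exI[of _ "image_mset monom N"])
        (use N card[of N] in \<open>auto simp: prod_mset_monom\<close>)
  }
qed

lemma nonpure_power_edge_ideal_iff:
  assumes "simple_graph n E"
  shows "p \<in> nonpure_power n k (edge_ideal n E :: ('k::field) mpoly set) \<longleftrightarrow>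
    p \<in> carrier (poly_ring n) \<and> (\<forall>m\<in>Poly_Mapping.keys p. nonpure_packs E k m)"
proof -
  let ?N = "{N. set_mset N \<subseteq> edge_vectors E \<and> size N = k \<and> card (set_mset N) > 1}"
  have keys: "Poly_Mapping.keys (sum_mset N) \<subseteq> {1..n}" if "set_mset N \<subseteq> edge_vectors E" for N
    using that keys_edge_vector[OF assms] by (induction N) (auto simp: keys_add_nat)
  have "(\<exists>s\<in>sum_mset ` ?N. s \<preceq> m) \<longleftrightarrow> nonpure_packs E k m" for m
    unfolding nonpure_packs_def by blast
  moreover have "\<forall>s\<in>sum_mset ` ?N. Poly_Mapping.keys s \<subseteq> {1..n}" using keys by blast
  ultimately show ?thesis
    unfolding nonpure_power_def nonpure_generators_eq[OF assms]
    by (simp only: genideal_monom_image_iff)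
qed

lemma edge_ideal_iff:
  assumes "simple_graph n E"
  shows "p \<in> (edge_ideal n E :: ('k::field) mpoly set) \<longleftrightarrow>
    p \<in> carrier (poly_ring n) \<and> (\<forall>m\<in>Poly_Mapping.keys p. \<exists>e\<in>edge_vectors E. e \<preceq> m)"
  unfolding edge_ideal_def edge_generators_eq
  by (rule genideal_monom_image_iff) (use keys_edge_vector[OF assms] in blast)

theorem theorem2p5:
  fixes n k :: nat and E :: "nat set set"
  assumes "simple_graph n E" and "E \<noteq> {}" and "k \<ge> 2"
  shows "colon_ideal (poly_ring n) (nonpure_power n (k + 1) (edge_ideal n E))
           (edge_ideal n E :: ('k::field) mpoly set)
         = nonpure_power n k (edge_ideal n E)"
proof (intro equalityI subsetI)
  let ?R = "poly_ring n :: 'k mpoly ring" and ?I = "edge_ideal n E :: 'k mpoly set"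
  interpret cring ?R by (rule cring_poly_ring)
  have E: "\<forall>e\<in>E. card e = 2" using assms(1) unfolding simple_graph_def by blast
  note mem = nonpure_power_edge_ideal_iff[OF assms(1), where 'k = 'k]
  have R_mult: "x \<otimes>\<^bsub>?R\<^esub> y = x * y" for x y by (simp add: poly_ring_def)
  fix f :: "'k mpoly"
  {
    assume f: "f \<in> colon_ideal ?R (nonpure_power n (k + 1) ?I) ?I"
    then have fR: "f \<in> carrier ?R" by (simp add: colon_ideal_def)
    \<comment> \<open>Multiplication by a monomial does not cancel any terms, so each monomial of \<open>f\<close> may be
      treated separately.\<close>
    have "nonpure_packs E k m" if m: "m \<in> Poly_Mapping.keys f" for m
    proof (rule nonpure_packs_colon[OF E assms(2,3)], rule ballI)
      fix e assume e: "e \<in> edge_vectors E"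
      then have "monom e \<in> ?I"
        using keys_edge_vector[OF assms(1) e]
        by (auto simp: edge_ideal_iff[OF assms(1)] poly_ring_def)
      then have "f * monom e \<in> nonpure_power n (k + 1) ?I"
        using f by (simp add: colon_ideal_def R_mult)
      then show "nonpure_packs E (Suc k) (m + e)" using keys_times_monom[OF m] by (simp add: mem)
    qed
    with fR show "f \<in> nonpure_power n k ?I" by (simp add: mem)
  }
  {
    assume f: "f \<in> nonpure_power n k ?I"
    then have fR: "f \<in> carrier ?R" by (simp add: mem)
    have "f * g \<in> nonpure_power n (k + 1) ?I" if g: "g \<in> ?I" for g
    proof -
      have gR: "g \<in> carrier ?R" using g by (simp add: edge_ideal_iff[OF assms(1)])
      have "f * g \<in> carrier ?R" using m_closed[OF fR gR] by (simp only: R_mult)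
      moreover have "nonpure_packs E (Suc k) m" if m: "m \<in> Poly_Mapping.keys (f * g)" for m
      proof -
        obtain c d where cd: "m = c + d" "c \<in> Poly_Mapping.keys f" "d \<in> Poly_Mapping.keys g"
          using m keys_mult[of f g] by blast
        obtain e t where et: "e \<in> edge_vectors E" "d = e + t"
          using g cd(3) unfolding edge_ideal_iff[OF assms(1)] pointwise_le_iff by blast
        have "nonpure_packs E k c" using f cd(2) by (simp add: mem)
        then have "nonpure_packs E (Suc k) (c + e + t)"
          by (intro nonpure_packs_mono nonpure_packs_add et(1))
        then show ?thesis by (simp add: cd(1) et(2) add.assoc)
      qed
      ultimately show ?thesis by (simp add: mem)
    qed
    with fR show "f \<in> colon_ideal ?R (nonpure_power n (k + 1) ?I) ?I"
      by (simp add: colon_ideal_def R_mult)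
  }
qed

end
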